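(* The $\mathrm{FO}(<)$-expressible fragment of $\mathrm{Mon}\Sigma^1_1$ is not $\mathrm{Tower}(o(\sqrt{m}))$-succinct in $\mathrm{FO}(<)$ on the class of linear orders. That is, there is no function $g\colon\mathbb{N}\to\mathbb{N}$ with $g(m)=o(\sqrt{m})$ such that for every $\mathrm{Mon}\Sigma^1_1$-sentence $\Phi$ of signature $\{<\}$ that is equivalent on all linear orders $\mathcal{A}_N$ to some $\mathrm{FO}(<)$-sentence, there exists an $\mathrm{FO}(<)$-sentence $\psi$ with $|\psi|\le \mathrm{Tower}(g(|\Phi|))$ and $\mathcal{A}_N\models\psi\iff\mathcal{A}_N\models\Phi$ for all $N\in\mathbb{N}$.
   Context: For $N\in\mathbb{N}$, $\mathcal{A}_N$ is the linear order with universe $\{0,\dots,N\}$ and natural order $<$; the class of linear orders is $\{\mathcal{A}_N:N\in\mathbb{N}\}$. $\mathrm{Mon}\Sigma^1_1$ is the class of monadic second-order formulas consisting of a prefix of existential quantifiers over unary relations (sets), followed by a first-order formula. $\mathrm{FO}(<)$ is first-order logic over signature $\{<\}$. The size of a formula is the number of nodes of its syntax tree. $\mathrm{Tower}\colon\mathbb{N}\to\mathbb{N}$ is defined by $\mathrm{Tower}(0)=1$ and $\mathrm{Tower}(h+1)=2^{\mathrm{Tower}(h)}$. *)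

theory Defs
  imports Complex_Main "HOL-Library.Landau_Symbols"
begin

text \<open>
  First-order formulas over \<open><\<close> and unary relation variables. First-order variables and
  unary relation variables are two separate sorts, each named by natural numbers;
  \<open>In X x\<close> is the atom \<open>X(x)\<close>.
\<close>

datatype fo =
    Less nat nat
  | Eq nat nat
  | In nat nat
  | Neg fo
  | Conj fo fo
  | Disj fo fo
  | Exists nat fo
  | Forall nat fo

datatype monsig = Matrix fo | ExSet nat monsig

primrec fo_size :: "fo \<Rightarrow> nat" where
  "fo_size (Less x y) = 1"
| "fo_size (Eq x y) = 1"
| "fo_size (In X x) = 1"
| "fo_size (Neg \<phi>) = 1 + fo_size \<phi>"
| "fo_size (Conj \<phi> \<psi>) = 1 + fo_size \<phi> + fo_size \<psi>"
| "fo_size (Disj \<phi> \<psi>) = 1 + fo_size \<phi> + fo_size \<psi>"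
| "fo_size (Exists x \<phi>) = 1 + fo_size \<phi>"
| "fo_size (Forall x \<phi>) = 1 + fo_size \<phi>"

primrec monsig_size :: "monsig \<Rightarrow> nat" where
  "monsig_size (Matrix \<phi>) = fo_size \<phi>"
| "monsig_size (ExSet X \<Phi>) = 1 + monsig_size \<Phi>"

primrec fo_free :: "fo \<Rightarrow> nat set" where
  "fo_free (Less x y) = {x, y}"
| "fo_free (Eq x y) = {x, y}"
| "fo_free (In X x) = {x}"
| "fo_free (Neg \<phi>) = fo_free \<phi>"
| "fo_free (Conj \<phi> \<psi>) = fo_free \<phi> \<union> fo_free \<psi>"
| "fo_free (Disj \<phi> \<psi>) = fo_free \<phi> \<union> fo_free \<psi>"
| "fo_free (Exists x \<phi>) = fo_free \<phi> - {x}"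
| "fo_free (Forall x \<phi>) = fo_free \<phi> - {x}"

primrec fo_rels :: "fo \<Rightarrow> nat set" where
  "fo_rels (Less x y) = {}"
| "fo_rels (Eq x y) = {}"
| "fo_rels (In X x) = {X}"
| "fo_rels (Neg \<phi>) = fo_rels \<phi>"
| "fo_rels (Conj \<phi> \<psi>) = fo_rels \<phi> \<union> fo_rels \<psi>"
| "fo_rels (Disj \<phi> \<psi>) = fo_rels \<phi> \<union> fo_rels \<psi>"
| "fo_rels (Exists x \<phi>) = fo_rels \<phi>"
| "fo_rels (Forall x \<phi>) = fo_rels \<phi>"

primrec monsig_free :: "monsig \<Rightarrow> nat set" where
  "monsig_free (Matrix \<phi>) = fo_free \<phi>"
| "monsig_free (ExSet X \<Phi>) = monsig_free \<Phi>"

primrec monsig_free_rels :: "monsig \<Rightarrow> nat set" where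
  "monsig_free_rels (Matrix \<phi>) = fo_rels \<phi>"
| "monsig_free_rels (ExSet X \<Phi>) = monsig_free_rels \<Phi> - {X}"

text \<open>
  A sentence of signature \<open>{<}\<close> has no free variables of either sort. A first-order formula
  does not bind relation variables, so for it this means that no relation variable occurs at all.
\<close>

definition fo_sentence :: "fo \<Rightarrow> bool" where
  "fo_sentence \<phi> \<longleftrightarrow> fo_free \<phi> = {} \<and> fo_rels \<phi> = {}"

definition monsig_sentence :: "monsig \<Rightarrow> bool" where
  "monsig_sentence \<Phi> \<longleftrightarrow> monsig_free \<Phi> = {} \<and> monsig_free_rels \<Phi> = {}"

text \<open>
  Satisfaction in the linear order with universe \<open>{0..N}\<close> and the natural order;
  \<open>R\<close> assigns sets to the relation variables, \<open>e\<close> assigns elements to the first-order variables.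
\<close>

primrec fo_sat :: "nat \<Rightarrow> (nat \<Rightarrow> nat set) \<Rightarrow> (nat \<Rightarrow> nat) \<Rightarrow> fo \<Rightarrow> bool" where
  "fo_sat N R e (Less x y) \<longleftrightarrow> e x < e y"
| "fo_sat N R e (Eq x y) \<longleftrightarrow> e x = e y"
| "fo_sat N R e (In X x) \<longleftrightarrow> e x \<in> R X"
| "fo_sat N R e (Neg \<phi>) \<longleftrightarrow> \<not> fo_sat N R e \<phi>"
| "fo_sat N R e (Conj \<phi> \<psi>) \<longleftrightarrow> fo_sat N R e \<phi> \<and> fo_sat N R e \<psi>"
| "fo_sat N R e (Disj \<phi> \<psi>) \<longleftrightarrow> fo_sat N R e \<phi> \<or> fo_sat N R e \<psi>"
| "fo_sat N R e (Exists x \<phi>) \<longleftrightarrow> (\<exists>a\<in>{0..N}. fo_sat N R (e(x := a)) \<phi>)"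
| "fo_sat N R e (Forall x \<phi>) \<longleftrightarrow> (\<forall>a\<in>{0..N}. fo_sat N R (e(x := a)) \<phi>)"

primrec monsig_sat :: "nat \<Rightarrow> (nat \<Rightarrow> nat set) \<Rightarrow> (nat \<Rightarrow> nat) \<Rightarrow> monsig \<Rightarrow> bool" where
  "monsig_sat N R e (Matrix \<phi>) \<longleftrightarrow> fo_sat N R e \<phi>"
| "monsig_sat N R e (ExSet X \<Phi>) \<longleftrightarrow> (\<exists>A. A \<subseteq> {0..N} \<and> monsig_sat N (R(X := A)) e \<Phi>)"

text \<open>
  The truth value of a sentence does not depend on the assignment, so a fixed one into the
  universe is used; the following two notions are meant for sentences only.
\<close>

definition fo_models :: "nat \<Rightarrow> fo \<Rightarrow> bool" where
  "fo_models N \<phi> \<longleftrightarrow> fo_sat N (\<lambda>_. {}) (\<lambda>_. 0) \<phi>"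

definition monsig_models :: "nat \<Rightarrow> monsig \<Rightarrow> bool" where
  "monsig_models N \<Phi> \<longleftrightarrow> monsig_sat N (\<lambda>_. {}) (\<lambda>_. 0) \<Phi>"

primrec Tower :: "nat \<Rightarrow> nat" where
  "Tower 0 = 1"
| "Tower (Suc h) = 2 ^ Tower h"

end

theory Submission imports Defs begin

text \<open>
  Let \<open>d\<^sub>0 = 1\<close> and \<open>d\<^sub>i\<^sub>+\<^sub>1 = d\<^sub>i * 2 ^ d\<^sub>i\<close>. Cut the order into blocks of length \<open>d\<^sub>i\<close> and let the
  bits of a set, read on the successive blocks, be a binary counter modulo \<open>2 ^ d\<^sub>i\<close>; it overflows
  every \<open>d\<^sub>i\<^sub>+\<^sub>1\<close> positions and so delimits the blocks of the next level. The counters are enforced by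
  a formula for congruence modulo \<open>d\<^sub>i\<close> of size \<open>O(i)\<close>, so guessing the block ends and the bits of \<open>h\<close> levels
  gives a monadic sentence of size \<open>O(h\<^sup>2)\<close> whose only model has \<open>d\<^sub>h \<ge> Tower h\<close> elements. A
  first-order sentence of size \<open>s\<close> does not distinguish \<open>N\<close> from \<open>N + 1\<close> once \<open>N + 1 \<ge> 2 ^ s\<close>, hence
  an equivalent one has size at least \<open>Tower (h - 1)\<close>.
\<close>

section \<open>First-order sentences cannot count far\<close>

text \<open>A single injection carries assignments from the shorter order to the longer one, so the
  invariant of the game below concerns one assignment \<open>e\<close> and one unoccupied
  gap.\<close>

definition shift :: "nat \<Rightarrow> nat \<Rightarrow> nat" where
  "shift l a = (if a < l then a else Suc a)"

lemma shift_less_iff [simp]: "shift l a < shift l b \<longleftrightarrow> a < b"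
  and shift_eq_iff [simp]: "shift l a = shift l b \<longleftrightarrow> a = b"
  by (auto simp: shift_def)

lemma shift_move_gap:
  assumes "\<forall>x. e x \<notin> {l..<l + n}" "l \<le> l'" "l' \<le> l + n"
  shows "(\<lambda>x. shift l (e x)) = (\<lambda>x. shift l' (e x))"
proof
  fix x
  have "e x < l \<or> l + n \<le> e x" using assms(1) by (meson atLeastLessThan_iff not_le)
  with assms(2,3) show "shift l (e x) = shift l' (e x)" by (auto simp: shift_def)
qed

text \<open>
  Stretching by one point a gap that no variable occupies is invisible to small formulas: a newly
  chosen point leaves at least half of the gap on one of its sides, and the place of
  the extra point inside the gap does not matter.
\<close>

lemma fo_sat_shift:
  assumes "fo_rels \<phi> = {}" "\<forall>x. e x \<notin> {l..<l + n}" "l + n \<le> Suc N" "2 ^ fo_size \<phi> \<le> Suc n"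
  shows "fo_sat N R e \<phi> \<longleftrightarrow> fo_sat (Suc N) R (\<lambda>x. shift l (e x)) \<phi>"
proof -
  \<comment> \<open>One back-and-forth round of an Ehrenfeucht-Fraisse game, stated for arbitrary
    \<open>P\<close> and \<open>Q\<close> so that \<open>Exists\<close> and \<open>Forall\<close>
    share it. The quantifier node pays for the factor 2 in front of \<open>m\<close>.\<close>
  have step: "(\<forall>a\<le>N. \<exists>b\<le>Suc N. P (e(x := a)) \<longleftrightarrow> Q ((\<lambda>x. shift l (e x))(x := b))) \<and>
              (\<forall>b\<le>Suc N. \<exists>a\<le>N. P (e(x := a)) \<longleftrightarrow> Q ((\<lambda>x. shift l (e x))(x := b)))"
    if gap: "\<forall>x. e x \<notin> {l..<l + n}" "l + n \<le> Suc N" "2 * m \<le> Suc n" "m > 0"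
      and IH: "\<And>e l n. \<forall>x. e x \<notin> {l..<l + n} \<Longrightarrow> l + n \<le> Suc N \<Longrightarrow> m \<le> Suc n \<Longrightarrow>
                 P e \<longleftrightarrow> Q (\<lambda>x. shift l (e x))"
    for e :: "nat \<Rightarrow> nat" and l n m x and P Q :: "(nat \<Rightarrow> nat) \<Rightarrow> bool"
  proof -
    have ext: "P (e(x := a)) \<longleftrightarrow> Q ((\<lambda>x. shift l (e x))(x := shift l' a))"
      if "a \<notin> {l'..<l' + n'}" "l \<le> l'" "l' + n' \<le> l + n" "m \<le> Suc n'" for a l' n'
    proof -
      have "\<forall>y. (e(x := a)) y \<notin> {l'..<l' + n'}"
      proof
        fix y
        have "e y < l \<or> l + n \<le> e y" using gap(1) by (meson atLeastLessThan_iff not_le)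
        with that show "(e(x := a)) y \<notin> {l'..<l' + n'}" by auto
      qed
      then have "P (e(x := a)) \<longleftrightarrow> Q (\<lambda>y. shift l' ((e(x := a)) y))"
        using gap(2) that by (intro IH) auto
      also have "(\<lambda>y. shift l' ((e(x := a)) y)) = (\<lambda>y. shift l' (e y))(x := shift l' a)"
        by auto
      finally show ?thesis
        using shift_move_gap[OF gap(1), of l'] that by (simp del: fun_upd_apply)
    qed
    have "\<exists>b\<le>Suc N. P (e(x := a)) \<longleftrightarrow> Q ((\<lambda>x. shift l (e x))(x := b))" if a: "a \<le> N" for a
    proof -
      \<comment> \<open>For \<open>a\<close> in the gap, the parts to its left and right have
        lengths whose successors add up to \<open>Suc n\<close>, so one of these successors is at
        least \<open>m\<close>.\<close>
      have "\<exists>l' n'. a \<notin> {l'..<l' + n'} \<and> l \<le> l' \<and> l' + n' \<le> l + n \<and> m \<le> Suc n'"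
      proof (cases "a \<in> {l..<l + n}")
        case False
        then show ?thesis using gap(3) by (intro exI[of _ l] exI[of _ n]) auto
      next
        case True
        show ?thesis
        proof (cases "m \<le> Suc (a - l)")
          case True
          with \<open>a \<in> _\<close> show ?thesis by (intro exI[of _ l] exI[of _ "a - l"]) auto
        next
          case False
          with \<open>a \<in> _\<close> gap(3) show ?thesis
            by (intro exI[of _ "Suc a"] exI[of _ "l + n - Suc a"]) auto
        qed
      qed
      then obtain l' n' where "a \<notin> {l'..<l' + n'}" "l \<le> l'" "l' + n' \<le> l + n" "m \<le> Suc n'"
        by blast
      from ext[OF this] show ?thesis
        using a by (intro exI[of _ "shift l' a"]) (auto simp: shift_def)
    qed
    moreover have "\<exists>a\<le>N. P (e(x := a)) \<longleftrightarrow> Q ((\<lambda>x. shift l (e x))(x := b))"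
      if b: "b \<le> Suc N" for b
    proof -
      have "\<exists>a l' n'. a \<le> N \<and> b = shift l' a \<and> a \<notin> {l'..<l' + n'} \<and> l \<le> l' \<and>
              l' + n' \<le> l + n \<and> m \<le> Suc n'"
      proof -
        \<comment> \<open>In the longer order the gap is \<open>{l..l + n}\<close>. If
          \<open>b\<close> is in it, either the left part is kept as the gap and \<open>b\<close> is
          the image of \<open>b - 1\<close>, or the right part is kept and \<open>b\<close> is its
          own image.\<close>
        consider "b < l" | "l + n < b" | "l + m \<le> b" "b \<le> l + n" | "l \<le> b" "b + m \<le> l + n"
          using gap(3) by linarith
        then show ?thesis
        proof cases
          case 1
          then show ?thesis using gap
            by (intro exI[of _ b] exI[of _ l] exI[of _ n]) (auto simp: shift_def)
        next
          case 2
          then show ?thesis using gap b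
            by (intro exI[of _ "b - 1"] exI[of _ l] exI[of _ n]) (auto simp: shift_def)
        next
          case 3
          then show ?thesis using gap b
            by (intro exI[of _ "b - 1"] exI[of _ l] exI[of _ "b - 1 - l"]) (auto simp: shift_def)
        next
          case 4
          then show ?thesis using gap b
            by (intro exI[of _ b] exI[of _ "Suc b"] exI[of _ "l + n - Suc b"])
              (auto simp: shift_def)
        qed
      qed
      then obtain a l' n' where a: "a \<le> N" "b = shift l' a" and
        *: "a \<notin> {l'..<l' + n'}" "l \<le> l'" "l' + n' \<le> l + n" "m \<le> Suc n'"
        by blast
      from ext[OF *] a show ?thesis by blast
    qed
    ultimately show ?thesis by blast
  qed
  show ?thesis
    using assms
  proof (induction \<phi> arbitrary: e l n)
    case (Conj \<phi>1 \<phi>2)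
    have "(2::nat) ^ fo_size \<phi>1 \<le> 2 ^ fo_size (Conj \<phi>1 \<phi>2)"
      "(2::nat) ^ fo_size \<phi>2 \<le> 2 ^ fo_size (Conj \<phi>1 \<phi>2)"
      by (rule power_increasing; simp)+
    with Conj.prems Conj.IH[of e l n] show ?case by simp
  next
    case (Disj \<phi>1 \<phi>2)
    have "(2::nat) ^ fo_size \<phi>1 \<le> 2 ^ fo_size (Disj \<phi>1 \<phi>2)"
      "(2::nat) ^ fo_size \<phi>2 \<le> 2 ^ fo_size (Disj \<phi>1 \<phi>2)"
      by (rule power_increasing; simp)+
    with Disj.prems Disj.IH[of e l n] show ?case by simp
  next
    case (Exists x \<phi>)
    have "fo_rels \<phi> = {}" using Exists.prems by simp
    then have "(\<forall>a\<le>N. \<exists>b\<le>Suc N. fo_sat N R (e(x := a)) \<phi> \<longleftrightarrow>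
                fo_sat (Suc N) R ((\<lambda>x. shift l (e x))(x := b)) \<phi>) \<and>
              (\<forall>b\<le>Suc N. \<exists>a\<le>N. fo_sat N R (e(x := a)) \<phi> \<longleftrightarrow>
                fo_sat (Suc N) R ((\<lambda>x. shift l (e x))(x := b)) \<phi>)"
      using Exists.prems(2-4) Exists.IH by (intro step[where m = "2 ^ fo_size \<phi>"]) simp_all
    then show ?case unfolding fo_sat.simps by (meson atLeastAtMost_iff le0)
  next
    case (Forall x \<phi>)
    have "fo_rels \<phi> = {}" using Forall.prems by simp
    then have "(\<forall>a\<le>N. \<exists>b\<le>Suc N. fo_sat N R (e(x := a)) \<phi> \<longleftrightarrow>
                fo_sat (Suc N) R ((\<lambda>x. shift l (e x))(x := b)) \<phi>) \<and>
              (\<forall>b\<le>Suc N. \<exists>a\<le>N. fo_sat N R (e(x := a)) \<phi> \<longleftrightarrow>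
                fo_sat (Suc N) R ((\<lambda>x. shift l (e x))(x := b)) \<phi>)"
      using Forall.prems(2-4) Forall.IH by (intro step[where m = "2 ^ fo_size \<phi>"]) simp_all
    then show ?case unfolding fo_sat.simps by (meson atLeastAtMost_iff le0)
  qed auto
qed

lemma fo_models_Suc_iff:
  assumes "fo_sentence \<psi>" "2 ^ fo_size \<psi> \<le> Suc N"
  shows "fo_models N \<psi> \<longleftrightarrow> fo_models (Suc N) \<psi>"
  \<comment> \<open>All variables sit at 0, which \<open>shift 1\<close> fixes, so the whole of
    \<open>{1..N}\<close> is a free gap of length \<open>N\<close>.\<close>
  using fo_sat_shift[of \<psi> "\<lambda>_. 0" 1 N N "\<lambda>_. {}"] assms
  by (simp add: fo_models_def fo_sentence_def shift_def)

section \<open>First-order definability of a single cardinality\<close>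

primrec above_fm :: "nat \<Rightarrow> fo" where
  "above_fm 0 = Eq 0 0"
| "above_fm (Suc n) = Exists n (Conj (Less n (Suc n)) (above_fm n))"

lemma above_fm_free: "fo_free (above_fm n) \<subseteq> {n}"
  by (induction n) auto

lemma above_fm_rels [simp]: "fo_rels (above_fm n) = {}"
  by (induction n) auto

lemma above_fm_sat: "e n \<le> N \<Longrightarrow> fo_sat N R e (above_fm n) \<longleftrightarrow> n \<le> e n"
proof (induction n arbitrary: e)
  case (Suc n)
  have "fo_sat N R e (above_fm (Suc n)) \<longleftrightarrow> (\<exists>a\<le>N. a < e (Suc n) \<and> n \<le> a)"
  proof -
    have "fo_sat N R (e(n := a)) (above_fm n) \<longleftrightarrow> n \<le> a" if "a \<le> N" for a
      using Suc.IH[of "e(n := a)"] that by (simp del: fun_upd_apply add: fun_upd_same)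
    then show ?thesis by auto
  qed
  also have "\<dots> \<longleftrightarrow> Suc n \<le> e (Suc n)"
    using Suc.prems by (auto intro!: exI[of _ n])
  finally show ?case .
qed auto

text \<open>Places the monadic sentences built below in the first-order expressible fragment; the
  size of this definition is irrelevant there.\<close>

lemma exists_fo_sentence_singleton:
  "\<exists>\<chi>. fo_sentence \<chi> \<and> (\<forall>N. fo_models N \<chi> \<longleftrightarrow> N = M)"
proof (intro exI conjI allI)
  let ?ge = "\<lambda>n. Exists n (above_fm n)"
  let ?\<chi> = "Conj (?ge M) (Neg (?ge (Suc M)))"
  show "fo_sentence ?\<chi>"
    using above_fm_free[of M] above_fm_free[of "Suc M"]
    unfolding fo_sentence_def by (auto simp del: above_fm.simps)
  have "fo_models N (?ge n) \<longleftrightarrow> n \<le> N" for N n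
    unfolding fo_models_def using above_fm_sat[of "(\<lambda>_. 0)(n := _)" n N]
    by (auto simp: Bex_def simp del: above_fm.simps)
  then show "fo_models N ?\<chi> \<longleftrightarrow> N = M" for N
    by (auto simp: fo_models_def simp del: above_fm.simps)
qed

section \<open>Nested binary counters\<close>

text \<open>The carry reaches bit \<open>j\<close> only through a run of ones. For even
  \<open>n\<close> it stops at bit 0; for odd \<open>n\<close> it becomes an increment of
  \<open>n div 2\<close>, to which the induction hypothesis applies.\<close>

lemma bit_Suc_nat_flip_iff:
  "bit (Suc n) j \<noteq> bit n j \<longleftrightarrow> (\<forall>k<j. bit n k)" for n :: nat
proof (induction j arbitrary: n)
  case 0
  show ?case by (simp add: bit_0)
next
  case (Suc j)
  show ?case
  proof (cases "even n")
    case True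
    then have "Suc n div 2 = n div 2" "\<not> bit n 0" by (auto simp: bit_0)
    then show ?thesis by (auto simp: bit_Suc)
  next
    case False
    then have "Suc n div 2 = Suc (n div 2)" "bit n 0" by (auto simp: bit_0)
    then show ?thesis using Suc.IH[of "n div 2"] by (simp add: bit_Suc All_less_Suc2)
  qed
qed

text \<open>The overflow condition of a counter with \<open>d\<close> bits; it will locate the block
  ends of the next level.\<close>

lemma all_bits_iff_dvd_Suc:
  "(\<forall>j<d. bit n j) \<longleftrightarrow> 2 ^ d dvd Suc n" for n :: nat
proof (induction d arbitrary: n)
  case (Suc d)
  show ?case
  proof (cases "even n")
    case True
    then show ?thesis by (auto simp: bit_0 dest: dvd_mult_left)
  next
    case False
    then have "Suc n = 2 * Suc (n div 2)" "bit n 0" by (auto simp: bit_0)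
    then have "2 ^ Suc d dvd Suc n \<longleftrightarrow> 2 ^ d dvd Suc (n div 2)"
      by (metis dvd_times_left_cancel_iff power_Suc zero_neq_numeral)
    with \<open>bit n 0\<close> show ?thesis using Suc.IH[of "n div 2"] by (simp add: bit_Suc All_less_Suc2)
  qed
qed auto

lemma low_bits_eq_iff_mod_eq:
  "(\<forall>j<d. bit m j \<longleftrightarrow> bit n j) \<longleftrightarrow> m mod 2 ^ d = n mod 2 ^ d" for m n :: nat
  unfolding take_bit_eq_mod[symmetric] bit_eq_iff[of "take_bit d m"] by (auto simp: bit_take_bit_iff)

text \<open>Each boundary crossed on the way from the block of \<open>x\<close> to the block of
  \<open>y\<close> contributes one end. The interval is half-open because an end belongs to the
  block that it closes. This makes "same block" and "next block" first-order expressible.\<close>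

lemma block_end_between_iff:
  fixes d :: nat
  assumes d: "d > 0"
  shows "x \<le> z \<and> z < y \<and> d dvd Suc z \<longleftrightarrow> (\<exists>k. x div d < k \<and> k \<le> y div d \<and> Suc z = d * k)"
proof
  assume *: "x \<le> z \<and> z < y \<and> d dvd Suc z"
  then obtain k where k: "Suc z = d * k" by (auto elim: dvdE)
  then have "x < k * d" "k * d \<le> y" using * by (auto simp: mult.commute)
  with k d show "\<exists>k. x div d < k \<and> k \<le> y div d \<and> Suc z = d * k"
    by (auto simp: div_less_iff_less_mult less_eq_div_iff_mult_less_eq)
next
  assume "\<exists>k. x div d < k \<and> k \<le> y div d \<and> Suc z = d * k"
  then obtain k where k: "x div d < k" "k \<le> y div d" "Suc z = d * k" by blast
  then have "x < k * d" "k * d \<le> y"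
    using d by (auto simp: div_less_iff_less_mult less_eq_div_iff_mult_less_eq)
  with k(3) show "x \<le> z \<and> z < y \<and> d dvd Suc z"
    by (auto simp: mult.commute)
qed

lemma exists_block_end_between_iff:
  fixes d :: nat
  assumes d: "d > 0"
  shows "(\<exists>z. x \<le> z \<and> z < y \<and> d dvd Suc z) \<longleftrightarrow> x div d < y div d"
proof -
  have "Suc (d * (y div d) - 1) = d * (y div d)" if "x div d < y div d"
    using that d by (metis Suc_diff_1 less_nat_zero_code nat_0_less_mult_iff neq0_conv)
  then show ?thesis unfolding block_end_between_iff[OF d] by auto
qed

lemma unique_block_end_between_iff:
  fixes d :: nat
  assumes d: "d > 0"
  shows "(\<exists>!z. x \<le> z \<and> z < y \<and> d dvd Suc z) \<longleftrightarrow> y div d = Suc (x div d)"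
proof -
  note ends = block_end_between_iff[OF d, of x _ y]
  show ?thesis
  proof
    assume ex1: "\<exists>!z. x \<le> z \<and> z < y \<and> d dvd Suc z"
    then have lt: "x div d < y div d" using exists_block_end_between_iff[OF d] by blast
    have "Suc (d * k - 1) = d * k" if "x div d < k" for k
      using that d by simp
    \<comment> \<open>The first and the last block end in the interval must coincide.\<close>
    then have "d * Suc (x div d) - 1 = d * (y div d) - 1"
      using ex1 ends[of "d * Suc (x div d) - 1"] ends[of "d * (y div d) - 1"] lt
      by (metis Suc_leI lessI order_refl)
    with lt d show "y div d = Suc (x div d)"
      by (metis Suc_diff_1 lessI mult_cancel1 nat_0_less_mult_iff not_gr_zero not_less_zero)
  next
    assume y: "y div d = Suc (x div d)"
    have "Suc (d * Suc (x div d) - 1) = d * Suc (x div d)" using d by simp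
    then show "\<exists>!z. x \<le> z \<and> z < y \<and> d dvd Suc z"
      unfolding ends y by (intro ex1I[of _ "d * Suc (x div d) - 1"])
        (auto, metis Suc_leI le_antisym diff_Suc_1 mult_Suc_right)
  qed
qed

primrec block_len :: "nat \<Rightarrow> nat" where
  "block_len 0 = 1"
| "block_len (Suc i) = block_len i * 2 ^ block_len i"

lemma block_len_pos [simp]: "block_len i > 0"
  by (induction i) auto

lemma Tower_le_block_len: "Tower i \<le> block_len i"
proof (induction i)
  case (Suc i)
  then have "(2::nat) ^ Tower i \<le> 2 ^ block_len i" by (simp add: power_increasing)
  also have "\<dots> \<le> block_len i * 2 ^ block_len i" using block_len_pos[of i] by (simp add: Suc_leI del: block_len_pos)
  finally show ?case by simp
qed auto


text \<open>The arithmetic behind \<open>cong_fm\<close>: a residue modulo \<open>d * 2 ^ d\<close>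
  consists of the offset in the block and the block number modulo \<open>2 ^ d\<close>. Comparing
  bits at equal offsets compares the block numbers; the last equivalence compares the offsets of
  \<open>X\<close> and \<open>Y\<close>.\<close>

lemma blockwise_agree_iff_mod_eq:
  fixes d :: nat
  assumes d: "d > 0" "d dvd Suc N" and le: "X \<le> N" "Y \<le> N"
  shows "(\<forall>u\<le>N. \<forall>v\<le>N. u div d = X div d \<longrightarrow> v div d = Y div d \<longrightarrow> u mod d = v mod d \<longrightarrow>
            (bit (u div d) (u mod d) \<longleftrightarrow> bit (v div d) (v mod d)) \<and> (u = X \<longleftrightarrow> v = Y)) \<longleftrightarrow>
         X mod (d * 2 ^ d) = Y mod (d * 2 ^ d)" (is "?L \<longleftrightarrow> ?R")
proof -
  \<comment> \<open>As \<open>d\<close> divides \<open>Suc N\<close>, no block is truncated and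
    every offset occurs in the blocks of \<open>X\<close> and \<open>Y\<close>.\<close>
  have in_block: "d * (x div d) + j \<le> N" if "x \<le> N" "j < d" for x j
  proof -
    obtain K where K: "Suc N = d * K" using d(2) by (auto elim: dvdE)
    then have "x div d < K" using that(1) d(1)
      by (metis div_less_iff_less_mult le_imp_less_Suc mult.commute)
    then have "d * Suc (x div d) \<le> Suc N" unfolding K by (intro mult_le_mono) auto
    with that(2) show ?thesis by simp
  qed
  have "?R \<longleftrightarrow> X mod d = Y mod d \<and> (X div d) mod 2 ^ d = (Y div d) mod 2 ^ d"
  proof
    assume R: ?R
    have "X mod d = Y mod d" using R by (metis dvd_triv_left mod_mod_cancel)
    with R d(1) show "X mod d = Y mod d \<and> (X div d) mod 2 ^ d = (Y div d) mod 2 ^ d"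
      by (simp add: mod_mult2_eq)
  qed (simp add: mod_mult2_eq)
  also have "\<dots> \<longleftrightarrow> X mod d = Y mod d \<and> (\<forall>j<d. bit (X div d) j \<longleftrightarrow> bit (Y div d) j)"
    by (simp add: low_bits_eq_iff_mod_eq)
  also have "\<dots> \<longleftrightarrow> ?L"
  proof
    assume R: "X mod d = Y mod d \<and> (\<forall>j<d. bit (X div d) j \<longleftrightarrow> bit (Y div d) j)"
    show ?L
    proof (intro allI impI conjI)
      fix u v
      assume uv: "u div d = X div d" "v div d = Y div d" "u mod d = v mod d"
      show "bit (u div d) (u mod d) \<longleftrightarrow> bit (v div d) (v mod d)"
        using R uv d(1) by simp
      show "u = X \<longleftrightarrow> v = Y" using R uv by (metis div_mult_mod_eq)
    qed
  next
    assume L: ?L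
    have *: "(bit (X div d) j \<longleftrightarrow> bit (Y div d) j) \<and>
        (d * (X div d) + j = X \<longleftrightarrow> d * (Y div d) + j = Y)" if "j < d" for j
      using L[rule_format, of "d * (X div d) + j" "d * (Y div d) + j"]
        in_block[OF le(1) that] in_block[OF le(2) that] that by simp
    \<comment> \<open>At the offset of \<open>X\<close> the position \<open>u\<close> is
      \<open>X\<close> itself, which forces \<open>v\<close> to be \<open>Y\<close>.\<close>
    have "d * (Y div d) + X mod d = Y" using *[of "X mod d"] d(1) by simp
    then have "X mod d = Y mod d" using d(1)
      by (metis mod_mod_trivial mod_mult_self4)
    with * show "X mod d = Y mod d \<and> (\<forall>j<d. bit (X div d) j \<longleftrightarrow> bit (Y div d) j)" by blast
  qed
  finally show ?thesis by blast
qed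

definition block_ends :: "nat \<Rightarrow> nat \<Rightarrow> nat set \<Rightarrow> bool" where
  "block_ends N i A \<longleftrightarrow> (\<forall>x\<le>N. x \<in> A \<longleftrightarrow> block_len i dvd Suc x)"

text \<open>The counter value is the block number, least significant bit first. The reduction modulo
  \<open>2 ^ block_len i\<close> is implicit, since only offsets below \<open>block_len i\<close>
  are read.\<close>

definition counter_bits :: "nat \<Rightarrow> nat \<Rightarrow> nat set \<Rightarrow> bool" where
  "counter_bits N i A \<longleftrightarrow> (\<forall>x\<le>N. x \<in> A \<longleftrightarrow> bit (x div block_len i) (x mod block_len i))"

section \<open>The monadic sentences\<close>

text \<open>
  Relation variable \<open>2 * i\<close> stands for the ends of the level \<open>i\<close> blocks and \<open>2 * i + 1\<close> for the
  bits of the level \<open>i\<close> counter. First-order variables \<open>2 * i + 2\<close> and \<open>2 * i + 3\<close> are the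
  arguments of \<open>cong_fm i\<close>; variables \<open>0\<close> and \<open>1\<close> are scratch.
\<close>

abbreviation Imp :: "fo \<Rightarrow> fo \<Rightarrow> fo" where
  "Imp \<phi> \<psi> \<equiv> Disj (Neg \<phi>) \<psi>"

abbreviation Iff :: "fo \<Rightarrow> fo \<Rightarrow> fo" where
  "Iff \<phi> \<psi> \<equiv> Conj (Imp \<phi> \<psi>) (Imp \<psi> \<phi>)"

abbreviation end_between :: "nat \<Rightarrow> nat \<Rightarrow> nat \<Rightarrow> nat \<Rightarrow> fo" where
  "end_between q x z y \<equiv> Conj (In q z) (Conj (Neg (Less z x)) (Less z y))"

definition same_block_fm :: "nat \<Rightarrow> nat \<Rightarrow> nat \<Rightarrow> fo" where
  "same_block_fm q x y =
     Forall 0 (Conj (Neg (end_between q x 0 y)) (Neg (end_between q y 0 x)))"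

definition next_block_fm :: "nat \<Rightarrow> nat \<Rightarrow> nat \<Rightarrow> fo" where
  "next_block_fm q x y =
     Exists 1 (Conj (end_between q x 1 y) (Forall 0 (Imp (end_between q x 0 y) (Eq 0 1))))"

text \<open>
  Two positions agree modulo the next block length if their blocks carry the same counter value
  and their offsets agree. The conjunct on \<open>u = x \<longleftrightarrow> v = y\<close> expresses the latter without a second
  copy of the recursive formula, which keeps the size linear.
\<close>

primrec cong_fm :: "nat \<Rightarrow> fo" where
  "cong_fm 0 = Eq 2 2"
| "cong_fm (Suc i) =
     Forall (2*i+2) (Forall (2*i+3)
       (Imp (same_block_fm (2*i) (2*i+2) (2*i+4))
         (Imp (same_block_fm (2*i) (2*i+3) (2*i+5))
           (Imp (cong_fm i)
             (Conj (Iff (In (2*i+1) (2*i+2)) (In (2*i+1) (2*i+3)))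
                   (Iff (Eq (2*i+2) (2*i+4)) (Eq (2*i+3) (2*i+5))))))))"

definition init_fm :: "nat \<Rightarrow> fo" where
  "init_fm i = Forall 2 (Disj (Exists 0 (Conj (Less 0 2) (In (2*i) 0))) (Neg (In (2*i+1) 2)))"

text \<open>Binary successor in the form of \<open>bit_Suc_nat_flip_iff\<close>: a bit is kept
  exactly if a lower bit of the earlier block is zero. The quantified variables are the arguments of
  \<open>cong_fm i\<close>.\<close>

definition incr_fm :: "nat \<Rightarrow> fo" where
  "incr_fm i =
     Forall (2*i+2) (Forall (2*i+3)
       (Imp (next_block_fm (2*i) (2*i+2) (2*i+3))
         (Imp (cong_fm i)
           (Iff (Iff (In (2*i+1) (2*i+2)) (In (2*i+1) (2*i+3)))
             (Exists 1 (Conj (Less 1 (2*i+2))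
               (Conj (same_block_fm (2*i) 1 (2*i+2)) (Neg (In (2*i+1) 1)))))))))"

text \<open>A block whose counter is all ones precedes an overflow, so its end also closes a block
  of level \<open>i + 1\<close>.\<close>

definition carry_fm :: "nat \<Rightarrow> fo" where
  "carry_fm i =
     Forall 2 (Iff (In (2*i+2) 2)
       (Conj (In (2*i) 2) (Forall 1 (Imp (same_block_fm (2*i) 1 2) (In (2*i+1) 1)))))"

primrec ruler_fm :: "nat \<Rightarrow> fo" where
  "ruler_fm 0 = Forall 2 (In 0 2)"
| "ruler_fm (Suc i) = Conj (ruler_fm i) (Conj (init_fm i) (Conj (incr_fm i) (carry_fm i)))"

text \<open>A mark on the last position makes the top-level block complete, and the absence of other
  marks makes it the only one.\<close>

definition single_block_fm :: "nat \<Rightarrow> fo" where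
  "single_block_fm h = Conj (ruler_fm h) (Forall 2 (Iff (In (2*h) 2) (Forall 0 (Neg (Less 2 0)))))"

section \<open>Semantics of the counter formulas\<close>

lemma block_ends_between:
  assumes "block_ends N i A" "y \<le> N"
  shows "z \<le> N \<and> z \<in> A \<and> \<not> z < x \<and> z < y \<longleftrightarrow> x \<le> z \<and> z < y \<and> block_len i dvd Suc z"
  using assms by (auto simp: block_ends_def)

lemma same_block_fm_sat:
  assumes "block_ends N i (R q)" "x \<noteq> 0" "y \<noteq> 0" "e x \<le> N" "e y \<le> N"
  shows "fo_sat N R e (same_block_fm q x y) \<longleftrightarrow> e x div block_len i = e y div block_len i"
proof -
  have "fo_sat N R e (same_block_fm q x y) \<longleftrightarrow>
      \<not> (\<exists>z. z \<le> N \<and> z \<in> R q \<and> \<not> z < e x \<and> z < e y) \<and>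
      \<not> (\<exists>z. z \<le> N \<and> z \<in> R q \<and> \<not> z < e y \<and> z < e x)"
    using assms(2,3) unfolding same_block_fm_def by auto
  also have "\<dots> \<longleftrightarrow> e x div block_len i = e y div block_len i"
    unfolding block_ends_between[OF assms(1,4)] block_ends_between[OF assms(1,5)]
    by (auto simp: exists_block_end_between_iff)
  finally show ?thesis .
qed

lemma next_block_fm_sat:
  assumes "block_ends N i (R q)" "x > 1" "y > 1" "e x \<le> N" "e y \<le> N"
  shows "fo_sat N R e (next_block_fm q x y) \<longleftrightarrow>
           e y div block_len i = Suc (e x div block_len i)"
proof -
  have "fo_sat N R e (next_block_fm q x y) \<longleftrightarrow>
      (\<exists>!z. z \<le> N \<and> z \<in> R q \<and> \<not> z < e x \<and> z < e y)"
    using assms(2,3) unfolding next_block_fm_def Ex1_def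
    by (simp add: Bex_def Ball_def) (rule ex_cong1, blast)
  also have "\<dots> \<longleftrightarrow> e y div block_len i = Suc (e x div block_len i)"
    unfolding block_ends_between[OF assms(1,5)] by (simp add: unique_block_end_between_iff)
  finally show ?thesis .
qed

lemma block_len_dvd_Suc: "block_len (Suc i) dvd n \<Longrightarrow> block_len i dvd n"
  by (simp add: dvd_mult_left)

text \<open>Only the levels below \<open>i\<close> have to be correct, so the lemma is available
  while the counter of level \<open>i\<close> is still being verified.\<close>

lemma cong_fm_sat:
  assumes "\<forall>j<i. block_ends N j (R (2*j)) \<and> counter_bits N j (R (2*j+1))"
    "block_len i dvd Suc N" "e (2*i+2) \<le> N" "e (2*i+3) \<le> N"
  shows "fo_sat N R e (cong_fm i) \<longleftrightarrow> e (2*i+2) mod block_len i = e (2*i+3) mod block_len i"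
  using assms
proof (induction i arbitrary: e)
  case (Suc i)
  let ?d = "block_len i" and ?X = "e (2*i+4)" and ?Y = "e (2*i+5)"
  have ends: "block_ends N i (R (2*i))" and bits: "counter_bits N i (R (2*i+1))"
    using Suc.prems(1) by auto
  have dvd: "?d dvd Suc N" using Suc.prems(2) by (rule block_len_dvd_Suc)
  have le: "?X \<le> N" "?Y \<le> N" using Suc.prems(3,4) by (simp_all add: eval_nat_numeral)
  have "fo_sat N R e (cong_fm (Suc i)) \<longleftrightarrow>
    (\<forall>u\<le>N. \<forall>v\<le>N. u div ?d = ?X div ?d \<longrightarrow> v div ?d = ?Y div ?d \<longrightarrow> u mod ?d = v mod ?d \<longrightarrow>
       (bit (u div ?d) (u mod ?d) \<longleftrightarrow> bit (v div ?d) (v mod ?d)) \<and> (u = ?X \<longleftrightarrow> v = ?Y))"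
  proof -
    have "fo_sat N R (e(2*i+2 := u, 2*i+3 := v)) (cong_fm i) \<longleftrightarrow> u mod ?d = v mod ?d"
      "fo_sat N R (e(2*i+2 := u, 2*i+3 := v)) (same_block_fm (2*i) (2*i+2) (2*i+4)) \<longleftrightarrow>
         u div ?d = ?X div ?d"
      "fo_sat N R (e(2*i+2 := u, 2*i+3 := v)) (same_block_fm (2*i) (2*i+3) (2*i+5)) \<longleftrightarrow>
         v div ?d = ?Y div ?d"
      "u \<in> R (2*i+1) \<longleftrightarrow> bit (u div ?d) (u mod ?d)"
      "v \<in> R (2*i+1) \<longleftrightarrow> bit (v div ?d) (v mod ?d)"
      if "u \<le> N" "v \<le> N" for u v
      using that le Suc.prems(1) dvd bits ends
      by (simp_all add: Suc.IH same_block_fm_sat[where i=i] counter_bits_def)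
    then show ?thesis
      unfolding cong_fm.simps fo_sat.simps atLeastAtMost_iff Ball_def by simp blast
  qed
  also have "\<dots> \<longleftrightarrow> ?X mod block_len (Suc i) = ?Y mod block_len (Suc i)"
    using blockwise_agree_iff_mod_eq[OF block_len_pos dvd le] by simp
  finally show ?case by (simp add: eval_nat_numeral)
qed auto


text \<open>The first block is fixed to zero and every later block is determined by its predecessor,
  so induction on the block number leaves only the intended bits.\<close>

lemma counter_bits_iff_incr:
  fixes d :: nat
  assumes d: "d > 0"
  shows "(\<forall>x\<le>N. x div d = 0 \<longrightarrow> x \<notin> A) \<and>
         (\<forall>x\<le>N. \<forall>y\<le>N. y div d = Suc (x div d) \<longrightarrow> x mod d = y mod d \<longrightarrow>
            ((x \<in> A \<longleftrightarrow> y \<in> A) \<longleftrightarrow> (\<exists>z<x. z div d = x div d \<and> z \<notin> A))) \<longleftrightarrow>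
         (\<forall>x\<le>N. x \<in> A \<longleftrightarrow> bit (x div d) (x mod d))" (is "?L \<longleftrightarrow> ?R")
proof -
  \<comment> \<open>The assumption reaches only up to \<open>x\<close> within its own block, so it
    can be met during the induction, when later blocks are still unknown.\<close>
  have lower: "(\<exists>z<x. z div d = x div d \<and> z \<notin> A) \<longleftrightarrow> (\<exists>k<x mod d. \<not> bit (x div d) k)"
    if A: "\<forall>z\<le>x. z div d = x div d \<longrightarrow> (z \<in> A \<longleftrightarrow> bit (x div d) (z mod d))" for x
  proof
    assume "\<exists>z<x. z div d = x div d \<and> z \<notin> A"
    then obtain z where z: "z < x" "z div d = x div d" "z \<notin> A" by blast
    then have "z mod d < x mod d" by (metis div_mult_mod_eq nat_add_left_cancel_less)
    moreover have "\<not> bit (x div d) (z mod d)" using A z by auto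
    ultimately show "\<exists>k<x mod d. \<not> bit (x div d) k" by blast
  next
    assume "\<exists>k<x mod d. \<not> bit (x div d) k"
    then obtain k where k: "k < x mod d" "\<not> bit (x div d) k" by blast
    have "k < d" using k(1) d by (meson mod_less_divisor order_less_trans)
    define z where "z = d * (x div d) + k"
    have z: "z div d = x div d" "z mod d = k" using \<open>k < d\<close> by (simp_all add: z_def)
    have "z < x" unfolding z_def using k(1) by (metis add_less_cancel_left mult_div_mod_eq)
    moreover have "z \<notin> A" using A z k \<open>z < x\<close> by auto
    ultimately show "\<exists>z<x. z div d = x div d \<and> z \<notin> A" using z(1) by blast
  qed
  show ?thesis
  proof
    assume R: ?R
    show ?L
    proof (intro conjI allI impI)
      fix x assume "x \<le> N" "x div d = 0"
      with R show "x \<notin> A" by simp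
    next
      fix x y
      assume *: "x \<le> N" "y \<le> N" "y div d = Suc (x div d)" "x mod d = y mod d"
      have "(\<exists>z<x. z div d = x div d \<and> z \<notin> A) \<longleftrightarrow> (\<exists>k<x mod d. \<not> bit (x div d) k)"
        using R *(1) by (intro lower) auto
      then show "(x \<in> A \<longleftrightarrow> y \<in> A) \<longleftrightarrow> (\<exists>z<x. z div d = x div d \<and> z \<notin> A)"
        using R * bit_Suc_nat_flip_iff[of "x div d" "x mod d"] by auto
    qed
  next
    assume L: ?L
    have "\<forall>x\<le>N. x div d = n \<longrightarrow> (x \<in> A \<longleftrightarrow> bit n (x mod d))" for n
    proof (induction n)
      case 0
      with L show ?case by auto
    next
      case (Suc n)
      show ?case
      proof (intro allI impI)
        fix y assume y: "y \<le> N" "y div d = Suc n"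
        \<comment> \<open>The position with the same offset in the preceding block.\<close>
        define x where "x = y - d"
        have "d \<le> y" using y(2) d by (metis div_less less_nat_zero_code not_less zero_less_Suc)
        then have x: "x \<le> N" "x div d = n" "x mod d = y mod d"
          using y d by (auto simp: x_def le_div_geq le_mod_geq)
        have "(\<exists>z<x. z div d = x div d \<and> z \<notin> A) \<longleftrightarrow> (\<exists>k<x mod d. \<not> bit (x div d) k)"
          using Suc.IH x by (intro lower) auto
        moreover have "(x \<in> A \<longleftrightarrow> y \<in> A) \<longleftrightarrow> (\<exists>z<x. z div d = x div d \<and> z \<notin> A)"
          using L x y by auto
        moreover have "x \<in> A \<longleftrightarrow> bit n (x mod d)" using Suc.IH x by auto
        ultimately show "y \<in> A \<longleftrightarrow> bit (Suc n) (y mod d)"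
          using bit_Suc_nat_flip_iff[of n "x mod d"] x by auto
      qed
    qed
    then show ?R by blast
  qed
qed

text \<open>Here \<open>x\<close> ends block number \<open>k\<close>, so
  \<open>Suc x = d * Suc k\<close>, and the bits of \<open>k\<close> below \<open>d\<close> are all
  ones iff \<open>2 ^ d\<close> divides \<open>Suc k\<close>.\<close>

lemma block_all_bits_iff_dvd:
  fixes d :: nat
  assumes d: "d > 0" "d dvd Suc x" "x \<le> N"
  shows "(\<forall>z\<le>N. z div d = x div d \<longrightarrow> bit (z div d) (z mod d)) \<longleftrightarrow> d * 2 ^ d dvd Suc x"
proof -
  obtain K where K: "Suc x = d * K" using d(2) by (auto elim: dvdE)
  then obtain k where k: "K = Suc k" by (cases K) auto
  have x: "x = d * k + (d - 1)" using K d(1) unfolding k by simp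
  have div: "x div d = k" by (rule div_nat_eqI) (use x d(1) in auto)
  have "(\<forall>z\<le>N. z div d = x div d \<longrightarrow> bit (z div d) (z mod d)) \<longleftrightarrow> (\<forall>j<d. bit k j)"
  proof
    assume L: "\<forall>z\<le>N. z div d = x div d \<longrightarrow> bit (z div d) (z mod d)"
    show "\<forall>j<d. bit k j"
    proof (intro allI impI)
      fix j assume "j < d"
      with L[rule_format, of "d * k + j"] x div d(3) show "bit k j" by simp
    qed
  qed (simp add: div d)
  also have "\<dots> \<longleftrightarrow> d * 2 ^ d dvd Suc x"
    unfolding K k all_bits_iff_dvd_Suc using d(1) by (simp del: mult_Suc_right)
  finally show ?thesis .
qed

lemma init_fm_sat:
  assumes "block_ends N i (R (2*i))"
  shows "fo_sat N R e (init_fm i) \<longleftrightarrow> (\<forall>x\<le>N. x div block_len i = 0 \<longrightarrow> x \<notin> R (2*i+1))"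
proof -
  have "(\<exists>z\<le>N. z < x \<and> z \<in> R (2*i)) \<longleftrightarrow> x div block_len i \<noteq> 0" if "x \<le> N" for x
    using block_ends_between[OF assms that, of _ 0]
      exists_block_end_between_iff[of "block_len i" 0 x] by auto
  then show ?thesis unfolding init_fm_def by (auto simp: Bex_def Ball_def)
qed

lemma incr_fm_sat:
  assumes "\<forall>j<i. block_ends N j (R (2*j)) \<and> counter_bits N j (R (2*j+1))"
    and ends: "block_ends N i (R (2*i))" and dvd: "block_len i dvd Suc N"
  shows "fo_sat N R e (incr_fm i) \<longleftrightarrow>
    (\<forall>x\<le>N. \<forall>y\<le>N. y div block_len i = Suc (x div block_len i) \<longrightarrow>
       x mod block_len i = y mod block_len i \<longrightarrow>
       ((x \<in> R (2*i+1) \<longleftrightarrow> y \<in> R (2*i+1)) \<longleftrightarrow>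
        (\<exists>z<x. z div block_len i = x div block_len i \<and> z \<notin> R (2*i+1))))"
proof -
  let ?d = "block_len i"
  have
    "fo_sat N R (e(2*i+2 := x, 2*i+3 := y)) (cong_fm i) \<longleftrightarrow> x mod ?d = y mod ?d"
    "fo_sat N R (e(2*i+2 := x, 2*i+3 := y)) (next_block_fm (2*i) (2*i+2) (2*i+3)) \<longleftrightarrow>
       y div ?d = Suc (x div ?d)"
    "fo_sat N R (e(2*i+2 := x, 2*i+3 := y))
       (Exists 1 (Conj (Less 1 (2*i+2)) (Conj (same_block_fm (2*i) 1 (2*i+2)) (Neg (In (2*i+1) 1))))) \<longleftrightarrow>
       (\<exists>z<x. z div ?d = x div ?d \<and> z \<notin> R (2*i+1))"
    if "x \<le> N" "y \<le> N" for x y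
  proof -
    show "fo_sat N R (e(2*i+2 := x, 2*i+3 := y)) (cong_fm i) \<longleftrightarrow> x mod ?d = y mod ?d"
      using assms that by (simp add: cong_fm_sat)
    show "fo_sat N R (e(2*i+2 := x, 2*i+3 := y)) (next_block_fm (2*i) (2*i+2) (2*i+3)) \<longleftrightarrow>
       y div ?d = Suc (x div ?d)"
      using ends that by (simp add: next_block_fm_sat[where i = i])
    have z: "z \<le> N" if "z < x" for z using \<open>x \<le> N\<close> that by simp
    have "fo_sat N R (e(2*i+2 := x, 2*i+3 := y, 1 := z)) (same_block_fm (2*i) 1 (2*i+2)) \<longleftrightarrow>
        z div ?d = x div ?d" if "z < x" for z
      using ends \<open>x \<le> N\<close> that by (simp add: same_block_fm_sat[where i = i])
    then show "fo_sat N R (e(2*i+2 := x, 2*i+3 := y))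
       (Exists 1 (Conj (Less 1 (2*i+2)) (Conj (same_block_fm (2*i) 1 (2*i+2)) (Neg (In (2*i+1) 1))))) \<longleftrightarrow>
       (\<exists>z<x. z div ?d = x div ?d \<and> z \<notin> R (2*i+1))"
      using z by (simp add: Bex_def) blast
  qed
  note sat = this
  show ?thesis
    unfolding incr_fm_def fo_sat.simps(4-6,8) Ball_def atLeastAtMost_iff
    using sat by (simp del: fo_sat.simps(7)) blast
qed

lemma carry_fm_sat:
  assumes ends: "block_ends N i (R (2*i))"
  shows "fo_sat N R e (carry_fm i) \<longleftrightarrow>
    (\<forall>x\<le>N. x \<in> R (2*i+2) \<longleftrightarrow>
       block_len i dvd Suc x \<and> (\<forall>z\<le>N. z div block_len i = x div block_len i \<longrightarrow> z \<in> R (2*i+1)))"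
proof -
  have "fo_sat N R (e(2 := x, 1 := z)) (same_block_fm (2*i) 1 2) \<longleftrightarrow>
      z div block_len i = x div block_len i" if "x \<le> N" "z \<le> N" for x z
    using ends that by (simp add: same_block_fm_sat[where i = i])
  moreover have "x \<in> R (2*i) \<longleftrightarrow> block_len i dvd Suc x" if "x \<le> N" for x
    using ends that by (simp add: block_ends_def)
  ultimately show ?thesis
    unfolding carry_fm_def by (auto simp: Ball_def)
qed


lemma level_sat:
  assumes "\<forall>j<i. block_ends N j (R (2*j)) \<and> counter_bits N j (R (2*j+1))"
    and ends: "block_ends N i (R (2*i))" and dvd: "block_len i dvd Suc N"
  shows "fo_sat N R e (init_fm i) \<and> fo_sat N R e (incr_fm i) \<and> fo_sat N R e (carry_fm i) \<longleftrightarrow>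
           counter_bits N i (R (2*i+1)) \<and> block_ends N (Suc i) (R (2*i+2))"
proof -
  have "fo_sat N R e (init_fm i) \<and> fo_sat N R e (incr_fm i) \<longleftrightarrow> counter_bits N i (R (2*i+1))"
    unfolding init_fm_sat[where R = R, OF ends] incr_fm_sat[where R = R, OF assms] counter_bits_def
    by (rule counter_bits_iff_incr) simp
  moreover have "fo_sat N R e (carry_fm i) \<longleftrightarrow> block_ends N (Suc i) (R (2*i+2))"
    if bits: "counter_bits N i (R (2*i+1))"
  proof -
    have "block_len i dvd Suc x \<and>
            (\<forall>z\<le>N. z div block_len i = x div block_len i \<longrightarrow> z \<in> R (2*i+1)) \<longleftrightarrow>
          block_len (Suc i) dvd Suc x" if "x \<le> N" for x
      using bits block_all_bits_iff_dvd[of "block_len i" x N] that block_len_dvd_Suc[of i "Suc x"]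
      by (auto simp: counter_bits_def)
    then show ?thesis
      unfolding carry_fm_sat[where R = R, OF ends] block_ends_def by blast
  qed
  ultimately show ?thesis by blast
qed

lemma ruler_fm_sat:
  assumes "block_len i dvd Suc N"
  shows "fo_sat N R e (ruler_fm i) \<longleftrightarrow>
    block_ends N i (R (2*i)) \<and> (\<forall>j<i. block_ends N j (R (2*j)) \<and> counter_bits N j (R (2*j+1)))"
  using assms
proof (induction i)
  case 0
  show ?case by (auto simp: block_ends_def)
next
  case (Suc i)
  have dvd: "block_len i dvd Suc N" using Suc.prems by (rule block_len_dvd_Suc)
  show ?case
    using Suc.IH[OF dvd] level_sat[of i N R e, OF _ _ dvd] by (auto simp: less_Suc_eq)
qed

text \<open>Supplies the divisibility assumed in \<open>ruler_fm_sat\<close>. By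
  \<open>carry_fm\<close>, an end of level \<open>Suc i\<close> is also one of level
  \<open>i\<close>; divisibility there validates the ruler one level up, where the mark on
  \<open>N\<close> then gives the claim.\<close>

lemma ruler_fm_end_dvd:
  "fo_sat N R e (ruler_fm i) \<Longrightarrow> N \<in> R (2*i) \<Longrightarrow> block_len i dvd Suc N"
proof (induction i)
  case (Suc i)
  have "N \<in> R (2*i)"
    using Suc.prems by (auto simp: carry_fm_def)
  then have dvd: "block_len i dvd Suc N" using Suc by simp
  have "fo_sat N R e (ruler_fm i)" using Suc.prems by simp
  then have "block_ends N (Suc i) (R (2*i+2))"
    using Suc.prems(1) ruler_fm_sat[OF dvd, of R e] level_sat[of i N R e, OF _ _ dvd] by simp
  with Suc.prems(2) show ?case by (simp add: block_ends_def)
qed simp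

lemma single_block_fm_sat_iff:
  "(\<exists>R. (\<forall>i<2*h+1. R i \<subseteq> {0..N}) \<and> (\<forall>i\<ge>2*h+1. R i = {}) \<and> fo_sat N R e (single_block_fm h)) \<longleftrightarrow>
     Suc N = block_len h" (is "?L \<longleftrightarrow> ?R")
proof -
  have sat: "fo_sat N R e (single_block_fm h) \<longleftrightarrow>
      fo_sat N R e (ruler_fm h) \<and> (\<forall>x\<le>N. x \<in> R (2*h) \<longleftrightarrow> x = N)" for R
  proof -
    have "(\<forall>y\<le>N. \<not> x < y) \<longleftrightarrow> x = N" if "x \<le> N" for x
      using that by (auto simp: not_less)
    then show ?thesis unfolding single_block_fm_def by (auto simp: Ball_def)
  qed
  show ?thesis
  proof
    assume ?L
    then obtain R where R: "fo_sat N R e (ruler_fm h)" "\<forall>x\<le>N. x \<in> R (2*h) \<longleftrightarrow> x = N"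
      using sat by blast
    have dvd: "block_len h dvd Suc N" using ruler_fm_end_dvd[OF R(1)] R(2) by simp
    then have ends: "block_ends N h (R (2*h))" using ruler_fm_sat R(1) by blast
    have "block_len h \<le> Suc N" using dvd by (simp add: dvd_imp_le)
    \<comment> \<open>The first block end lies inside the order, and the only marked position is
      \<open>N\<close>.\<close>
    then have "block_len h - 1 \<in> R (2*h)"
      using ends by (simp add: block_ends_def le_diff_conv)
    then have "block_len h - 1 = N" using R(2) \<open>block_len h \<le> Suc N\<close> by simp
    then show ?R using block_len_pos[of h] by linarith
  next
    assume N: ?R
    \<comment> \<open>The intended ruler. The top level has ends but no counter, hence
      \<open>2*h+1\<close> relations; the rest are empty to match the assignment in
      \<open>monsig_models\<close>.\<close>
    define R where "R j = (if j \<ge> 2*h+1 then {} else if even j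
      then {x. x \<le> N \<and> block_len (j div 2) dvd Suc x}
      else {x. x \<le> N \<and> bit (x div block_len (j div 2)) (x mod block_len (j div 2))})" for j
    have "fo_sat N R e (ruler_fm h)"
      using N by (subst ruler_fm_sat) (auto simp: R_def block_ends_def counter_bits_def)
    moreover have "x \<in> R (2*h) \<longleftrightarrow> x = N" if "x \<le> N" for x
      using N that by (auto simp: R_def dest: dvd_imp_le)
    moreover have "\<forall>i<2*h+1. R i \<subseteq> {0..N}" by (auto simp: R_def)
    moreover have "\<forall>i\<ge>2*h+1. R i = {}" by (auto simp: R_def)
    ultimately show ?L using sat by blast
  qed
qed

section \<open>Quantifier prefix, free variables and size\<close>

primrec ex_sets :: "nat \<Rightarrow> monsig \<Rightarrow> monsig" where
  "ex_sets 0 \<Phi> = \<Phi>"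
| "ex_sets (Suc n) \<Phi> = ExSet n (ex_sets n \<Phi>)"

lemma ex_sets_sat:
  "monsig_sat N R e (ex_sets n \<Phi>) \<longleftrightarrow>
     (\<exists>R'. (\<forall>i<n. R' i \<subseteq> {0..N}) \<and> (\<forall>i\<ge>n. R' i = R i) \<and> monsig_sat N R' e \<Phi>)"
proof (induction n arbitrary: R)
  case 0
  have "R' = R" if "\<forall>i. R' i = R i" for R' using that by auto
  then show ?case by auto
next
  case (Suc n)
  show ?case
  proof
    assume "monsig_sat N R e (ex_sets (Suc n) \<Phi>)"
    then obtain A R' where A: "A \<subseteq> {0..N}" and R': "\<forall>i<n. R' i \<subseteq> {0..N}"
      "\<forall>i\<ge>n. R' i = (R(n := A)) i" "monsig_sat N R' e \<Phi>"
      by (auto simp: Suc.IH simp del: fun_upd_apply)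
    then show "\<exists>R'. (\<forall>i<Suc n. R' i \<subseteq> {0..N}) \<and> (\<forall>i\<ge>Suc n. R' i = R i) \<and> monsig_sat N R' e \<Phi>"
      by (intro exI[of _ R']) (auto simp: less_Suc_eq)
  next
    assume "\<exists>R'. (\<forall>i<Suc n. R' i \<subseteq> {0..N}) \<and> (\<forall>i\<ge>Suc n. R' i = R i) \<and> monsig_sat N R' e \<Phi>"
    then obtain R' where R': "\<forall>i<Suc n. R' i \<subseteq> {0..N}" "\<forall>i\<ge>Suc n. R' i = R i"
      "monsig_sat N R' e \<Phi>" by blast
    then have "monsig_sat N (R(n := R' n)) e (ex_sets n \<Phi>)"
      unfolding Suc.IH by (intro exI[of _ R']) auto
    with R'(1) show "monsig_sat N R e (ex_sets (Suc n) \<Phi>)" by auto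
  qed
qed

lemma ex_sets_free [simp]: "monsig_free (ex_sets n \<Phi>) = monsig_free \<Phi>"
  by (induction n) auto

lemma ex_sets_free_rels [simp]: "monsig_free_rels (ex_sets n \<Phi>) = monsig_free_rels \<Phi> - {..<n}"
proof (induction n)
  case (Suc n)
  then show ?case by (simp add: lessThan_Suc) blast
qed simp

lemma ex_sets_size [simp]: "monsig_size (ex_sets n \<Phi>) = n + monsig_size \<Phi>"
  by (induction n) auto

lemma same_block_fm_free [simp]: "fo_free (same_block_fm q x y) = {x, y} - {0}"
  and next_block_fm_free [simp]: "fo_free (next_block_fm q x y) = {x, y} - {1}"
  by (auto simp: same_block_fm_def next_block_fm_def)

lemma cong_fm_free: "fo_free (cong_fm i) \<subseteq> {2*i+2, 2*i+3}"
proof (induction i)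
  case (Suc i)
  have "fo_free (cong_fm i) \<subseteq> {2*i+2, 2*i+3, 2*i+4, 2*i+5}" using Suc by blast
  then show ?case
    unfolding cong_fm.simps fo_free.simps same_block_fm_free
    by (simp add: Diff_subset_conv insert_commute eval_nat_numeral)
qed simp

lemma ruler_fm_free: "fo_free (ruler_fm i) = {}"
proof (induction i)
  case (Suc i)
  then show ?case
    using cong_fm_free[of i]
    by (auto simp: init_fm_def incr_fm_def carry_fm_def)
qed auto

lemma cong_fm_rels: "fo_rels (cong_fm i) \<subseteq> {..<2*i}"
  by (induction i) (auto simp: same_block_fm_def)

lemma ruler_fm_rels: "fo_rels (ruler_fm i) \<subseteq> {..2*i}"
proof (induction i)
  case (Suc i)
  then show ?case
    using cong_fm_rels[of i]
    by (fastforce simp: init_fm_def incr_fm_def carry_fm_def same_block_fm_def next_block_fm_def)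
qed auto

text \<open>Linear because \<open>cong_fm i\<close> occurs only once in
  \<open>cong_fm (Suc i)\<close>.\<close>

lemma cong_fm_size: "fo_size (cong_fm i) = 1 + 59 * i"
  by (induction i) (auto simp: same_block_fm_def)

text \<open>Each level adds one copy of a linear-size \<open>cong_fm\<close>. The resulting square
  is the source of the square root in the theorem.\<close>

lemma ruler_fm_size: "fo_size (ruler_fm i) \<le> 100 * (i + 1) ^ 2"
proof (induction i)
  case (Suc i)
  then show ?case
    by (simp add: init_fm_def incr_fm_def carry_fm_def same_block_fm_def next_block_fm_def
        cong_fm_size power2_eq_square)
qed auto

definition single_block_sentence :: "nat \<Rightarrow> monsig" where
  "single_block_sentence h = ex_sets (2*h+1) (Matrix (single_block_fm h))"

lemma single_block_sentence_is_sentence: "monsig_sentence (single_block_sentence h)"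
  using ruler_fm_free[of h] ruler_fm_rels[of h]
  unfolding monsig_sentence_def single_block_sentence_def single_block_fm_def
  by (simp add: subset_iff) fastforce

lemma single_block_sentence_models:
  "monsig_models N (single_block_sentence h) \<longleftrightarrow> Suc N = block_len h"
  unfolding monsig_models_def single_block_sentence_def ex_sets_sat monsig_sat.simps
  by (rule single_block_fm_sat_iff)

text \<open>The lower bound makes the sizes unbounded, as an asymptotic hypothesis requires; 121 is
  chosen as the square of 11.\<close>

lemma single_block_sentence_size:
  "h \<le> monsig_size (single_block_sentence h)"
  "monsig_size (single_block_sentence h) \<le> 121 * (h + 1) ^ 2"
  using ruler_fm_size[of h]
  by (simp_all add: single_block_sentence_def single_block_fm_def power2_eq_square)

section \<open>Comparing towers and deriving the contradiction\<close>

lemma Tower_strict_mono: "strict_mono Tower"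
  by (simp add: strict_mono_Suc_iff)

theorem theorem6p5:
  "\<not> (\<exists>g :: nat \<Rightarrow> nat.
        (\<lambda>m. real (g m)) \<in> o(\<lambda>m. sqrt (real m)) \<and>
        (\<forall>\<Phi>. monsig_sentence \<Phi> \<and>
              (\<exists>\<chi>. fo_sentence \<chi> \<and> (\<forall>N. fo_models N \<chi> \<longleftrightarrow> monsig_models N \<Phi>)) \<longrightarrow>
              (\<exists>\<psi>. fo_sentence \<psi> \<and> fo_size \<psi> \<le> Tower (g (monsig_size \<Phi>)) \<and>
                   (\<forall>N. fo_models N \<psi> \<longleftrightarrow> monsig_models N \<Phi>))))"
proof
  assume "\<exists>g :: nat \<Rightarrow> nat.
        (\<lambda>m. real (g m)) \<in> o(\<lambda>m. sqrt (real m)) \<and>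
        (\<forall>\<Phi>. monsig_sentence \<Phi> \<and>
              (\<exists>\<chi>. fo_sentence \<chi> \<and> (\<forall>N. fo_models N \<chi> \<longleftrightarrow> monsig_models N \<Phi>)) \<longrightarrow>
              (\<exists>\<psi>. fo_sentence \<psi> \<and> fo_size \<psi> \<le> Tower (g (monsig_size \<Phi>)) \<and>
                   (\<forall>N. fo_models N \<psi> \<longleftrightarrow> monsig_models N \<Phi>)))"
  then obtain g :: "nat \<Rightarrow> nat" where g: "(\<lambda>m. real (g m)) \<in> o(\<lambda>m. sqrt (real m))"
    and succinct: "\<And>\<Phi> \<chi>. monsig_sentence \<Phi> \<Longrightarrow> fo_sentence \<chi> \<Longrightarrow>
        (\<forall>N. fo_models N \<chi> \<longleftrightarrow> monsig_models N \<Phi>) \<Longrightarrow>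
        \<exists>\<psi>. fo_sentence \<psi> \<and> fo_size \<psi> \<le> Tower (g (monsig_size \<Phi>)) \<and>
          (\<forall>N. fo_models N \<psi> \<longleftrightarrow> monsig_models N \<Phi>)"
    by blast
  have lower: "h \<le> g (monsig_size (single_block_sentence h))" for h
  proof -
    let ?\<Phi> = "single_block_sentence h"
    define M where "M = block_len h - 1"
    have M: "Suc M = block_len h" using block_len_pos[of h] by (simp add: M_def)
    have models: "monsig_models N ?\<Phi> \<longleftrightarrow> N = M" for N
      unfolding single_block_sentence_models M[symmetric] by simp
    obtain \<chi> where "fo_sentence \<chi>" "\<forall>N. fo_models N \<chi> \<longleftrightarrow> N = M"
      using exists_fo_sentence_singleton by blast
    then obtain \<psi> where \<psi>: "fo_sentence \<psi>" "fo_size \<psi> \<le> Tower (g (monsig_size ?\<Phi>))"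
      "\<forall>N. fo_models N \<psi> \<longleftrightarrow> N = M"
      using succinct[OF single_block_sentence_is_sentence, of \<chi> h] unfolding models by blast
    have "\<not> 2 ^ fo_size \<psi> \<le> Suc M"
      using fo_models_Suc_iff[OF \<psi>(1), of M] \<psi>(3) by auto
    then have "Tower h < 2 ^ fo_size \<psi>"
      using Tower_le_block_len[of h] M by linarith
    \<comment> \<open>The exponential in the indistinguishability bound costs one tower level; the
      strict inequality before it recovers that level, giving \<open>h\<close> and not
      \<open>h - 1\<close> as the lower bound.\<close>
    also have "\<dots> \<le> Tower (Suc (g (monsig_size ?\<Phi>)))"
      using \<psi>(2) by (simp add: power_increasing)
    finally show ?thesis
      by (simp only: strict_mono_less[OF Tower_strict_mono] less_Suc_eq_le)
  qed
  \<comment> \<open>The factor \<open>1 / 22\<close> turns the size bound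
    \<open>11 * (h + 1)\<close> under the root into \<open>(h + 1) / 2\<close>.\<close>
  have "eventually (\<lambda>m. norm (real (g m)) \<le> 1 / 22 * norm (sqrt (real m))) at_top"
    using g by (rule landau_o.smallD) simp
  then obtain m0 where m0: "\<And>m. m \<ge> m0 \<Longrightarrow> real (g m) \<le> 1 / 22 * sqrt (real m)"
    by (auto simp: eventually_at_top_linorder)
  \<comment> \<open>The size is at least \<open>h\<close>, hence beyond \<open>m0\<close>, and
    \<open>h > 1\<close> makes \<open>(h + 1) / 2\<close> smaller than \<open>h\<close>.\<close>
  define h where "h = m0 + 2"
  let ?m = "monsig_size (single_block_sentence h)"
  have "real h \<le> real (g ?m)" using lower by simp
  also have "\<dots> \<le> 1 / 22 * sqrt (real ?m)"
    using single_block_sentence_size(1)[of h] by (intro m0) (simp add: h_def)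
  also have "\<dots> \<le> 1 / 22 * sqrt ((11 * real (h + 1)) ^ 2)"
  proof -
    have "real ?m \<le> real (121 * (h + 1) ^ 2)"
      using single_block_sentence_size(2)[of h] by (simp only: of_nat_le_iff)
    also have "\<dots> = (11 * real (h + 1)) ^ 2" by (simp only: of_nat_mult of_nat_power power_mult_distrib) simp
    finally show ?thesis by (intro mult_left_mono real_sqrt_le_mono) auto
  qed
  also have "\<dots> = real (h + 1) / 2" by simp
  finally show False by (simp add: h_def)
qed

end
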